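(* Let $q\ge 0$ be an integer and let $S$ be a finite relative simplicial complex equipped with a Morse tiling whose $q$-quiver is acyclic. Then the $q$-skeleton $S^{(q)}$ is Morse shellable. Moreover there are subsets $\emptyset=S_0\subset S_1\subset\dots\subset S_N$ of $S$ such that $S_j\cap S^{(q)}$ is closed in $S^{(q)}$ for every $j\in\{0,\dots,N\}$, $S_N\cap S^{(q)}=S^{(q)}$, and for every $j\in\{1,\dots,N\}$, $S_j\setminus S_{j-1}$ consists of a single tile of order $\le q+1$ of the tiling of $S$.
   Context: Simplices are closed; an open simplex is the relative interior of a simplex. A finite relative simplicial complex is a complement $S=K\setminus L$, where $L$ is a (possibly empty) subcomplex of a finite simplicial complex $K$; it is regarded as the union of the open simplices of $K$ that are not in $L$, with the topology induced from $K$. Its $q$-skeleton is the finite relative simplicial complex $S^{(q)}=K^{(q)}\setminus L^{(q)}$, i.e. the union of the open simplices of $S$ of dimension $\le q$. Morse tiles: a Morse tile $T$ of dimension $n\ge 0$ and order $k\in\{0,\dots,n+1\}$ is an $n$-simplex $\overline T$ (its underlying simplex) from which one removes $k$ of its (closed) codimension one faces together with one possibly empty (closed) face $\mu$ of codimension greater than one, called its Morse face; when $\mu$ is non-empty it is understood not to be contained in the removed codimension one faces. Morse tiling: a Morse tiling of $S$ is a partition of $S$ by Morse tiles (each tile $T\subset S$ having underlying simplex $\overline T\in K$) such that for every $j\ge 0$ the union of the tiles of dimension greater than $j$ is closed in $S$. A Morse tiling of $S$ is shellable iff there is a filtration $\emptyset=S_0\subset S_1\subset\dots\subset S_N=S$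 by closed subsets of $S$ such that each $S_j\setminus S_{j-1}$ is a single tile. A finite relative simplicial complex is Morse shellable iff it admits a shellable Morse tiling. $q$-quiver: the $q$-quiver of a Morse tiling of $S$ is the directed graph whose vertices are the tiles of order $\le q+1$ and which contains an arrow $T\to T'$, for $T\neq T'$, iff $\overline T\cap T'\cap S^{(q)}\ne\emptyset$. It is acyclic iff it contains no oriented cycle, that is, no path of positive length (finite sequence of arrows, the target of each being the source of the next) with the same source and target. *)

theory Defs
  imports "HOL-Analysis.Analysis" "HOL-Library.Disjoint_Sets"
begin

text \<open>
  A finite relative simplicial complex is given by a pair \<open>(K, L)\<close> of geometric simplicial
  complexes in a Euclidean space. The library's \<^const>\<open>simplicial_complex\<close> also has the empty
  set (of dimension \<open>- 1\<close>) as a face; it has empty relative interior, so it never contributes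
  to the underlying space.
\<close>

definition relative_simplicial_complex ::
  "'a::euclidean_space set set \<Rightarrow> 'a set set \<Rightarrow> bool" where
  "relative_simplicial_complex K L \<longleftrightarrow>
     simplicial_complex K \<and> simplicial_complex L \<and> L \<subseteq> K"

definition relative_space :: "'a::euclidean_space set set \<Rightarrow> 'a set set \<Rightarrow> 'a set" where
  "relative_space K L = (\<Union>\<sigma>\<in>K - L. rel_interior \<sigma>)"

definition skeleton :: "nat \<Rightarrow> 'a::euclidean_space set set \<Rightarrow> 'a set set" where
  "skeleton q K = {\<sigma> \<in> K. aff_dim \<sigma> \<le> int q}"

text \<open>
  \<open>morse_tile \<sigma> n k T\<close>: the set \<open>T\<close> is a Morse tile of dimension \<open>n\<close> and order \<open>k\<close> with
  underlying simplex \<open>\<sigma>\<close>; here \<open>A\<close> consists of the removed codimension one faces and \<open>\<mu>\<close> is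
  the Morse face. The bound \<open>k \<le> n + 1\<close> is automatic. Codimension one faces are not
  rendered by \<open>facet_of\<close>, which excludes the empty face: for \<open>n = 0\<close> the empty face has
  codimension one, so that all orders \<open>0, \<dots>, n + 1\<close> occur in every dimension. Hence a point
  is a tile both of order \<open>0\<close> and of order \<open>1\<close>, whereas for \<open>n \<ge> 1\<close> the order is determined by
  \<open>T\<close>.
\<close>

definition morse_tile :: "'a::euclidean_space set \<Rightarrow> nat \<Rightarrow> nat \<Rightarrow> 'a set \<Rightarrow> bool" where
  "morse_tile \<sigma> n k T \<longleftrightarrow>
     int n simplex \<sigma> \<and>
     (\<exists>A \<mu>. A \<subseteq> {F. F face_of \<sigma> \<and> aff_dim F = int n - 1} \<and> card A = k \<and>
            \<mu> face_of \<sigma> \<and>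
            (\<mu> = {} \<or> (aff_dim \<mu> < int n - 1 \<and> \<not> \<mu> \<subseteq> \<Union>A)) \<and>
            T = \<sigma> - (\<Union>A \<union> \<mu>))"

definition underlying_simplex :: "'a::euclidean_space set \<Rightarrow> 'a set" where
  "underlying_simplex T = (THE \<sigma>. \<exists>n k. morse_tile \<sigma> n k T)"

definition tile_dim :: "'a::euclidean_space set \<Rightarrow> nat" where
  "tile_dim T = (THE n. \<exists>\<sigma> k. morse_tile \<sigma> n k T)"

definition tile_order_le :: "'a::euclidean_space set \<Rightarrow> nat \<Rightarrow> bool" where
  "tile_order_le T m \<longleftrightarrow> (\<exists>\<sigma> n k. morse_tile \<sigma> n k T \<and> k \<le> m)"

lemma morse_tile_closure:
  assumes "morse_tile \<sigma> n k T"
  shows "closure T = \<sigma>"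
proof -
  from assms obtain A \<mu> where
    \<sigma>: "int n simplex \<sigma>" and
    A: "A \<subseteq> {F. F face_of \<sigma> \<and> aff_dim F = int n - 1}" and
    \<mu>: "\<mu> face_of \<sigma>" "\<mu> = {} \<or> aff_dim \<mu> < int n - 1" and
    T: "T = \<sigma> - (\<Union>A \<union> \<mu>)"
    unfolding morse_tile_def by blast
  have dim: "aff_dim \<sigma> = int n" using \<sigma> by (rule aff_dim_simplex)
  have "F \<inter> rel_interior \<sigma> = {}" if "F \<in> A" for F
    using that A dim by (intro face_of_disjoint_rel_interior) force+
  moreover have "\<mu> \<inter> rel_interior \<sigma> = {}"
    using \<mu> dim by (cases "\<mu> = {}") (auto intro!: face_of_disjoint_rel_interior simp del: Int_iff)
  ultimately have "rel_interior \<sigma> \<subseteq> T"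
    using T rel_interior_subset by blast
  hence "closure (rel_interior \<sigma>) \<subseteq> closure T" by (rule closure_mono)
  moreover have "closure (rel_interior \<sigma>) = \<sigma>"
    using \<sigma> by (simp add: convex_closure_rel_interior convex_simplex closed_simplex)
  moreover have "closure T \<subseteq> \<sigma>"
    using \<sigma> T by (intro closure_minimal) (auto simp: closed_simplex)
  ultimately show ?thesis by blast
qed

lemma underlying_simplex_eq:
  assumes "morse_tile \<sigma> n k T"
  shows "underlying_simplex T = \<sigma>"
  unfolding underlying_simplex_def
proof (rule the_equality)
  show "\<exists>n k. morse_tile \<sigma> n k T" using assms by auto
next
  fix \<tau> assume "\<exists>n k. morse_tile \<tau> n k T"
  then obtain m l where "morse_tile \<tau> m l T" by auto
  thus "\<tau> = \<sigma>" using morse_tile_closure[OF assms] morse_tile_closure by auto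
qed

lemma tile_dim_eq:
  assumes "morse_tile \<sigma> n k T"
  shows "tile_dim T = n"
  unfolding tile_dim_def
proof (rule the_equality)
  show "\<exists>\<sigma> k. morse_tile \<sigma> n k T" using assms by auto
next
  have dim: "aff_dim \<tau> = int m" if "morse_tile \<tau> m l T" for \<tau> m l
    using that aff_dim_simplex unfolding morse_tile_def by auto
  fix m assume "\<exists>\<tau> l. morse_tile \<tau> m l T"
  then obtain \<tau> l where *: "morse_tile \<tau> m l T" by auto
  have "\<tau> = \<sigma>" using morse_tile_closure[OF assms] morse_tile_closure[OF *] by simp
  thus "m = n" using dim[OF *] dim[OF assms] by simp
qed

definition morse_tiling ::
  "'a::euclidean_space set set \<Rightarrow> 'a set set \<Rightarrow> 'a set set \<Rightarrow> bool" where
  "morse_tiling K L \<T> \<longleftrightarrow>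
     relative_simplicial_complex K L \<and>
     partition_on (relative_space K L) \<T> \<and>
     (\<forall>T\<in>\<T>. \<exists>\<sigma>\<in>K. \<exists>n k. morse_tile \<sigma> n k T) \<and>
     (\<forall>j. closedin (top_of_set (relative_space K L)) (\<Union>{T \<in> \<T>. j < tile_dim T}))"

definition shellable_tiling ::
  "'a::euclidean_space set set \<Rightarrow> 'a set set \<Rightarrow> 'a set set \<Rightarrow> bool" where
  "shellable_tiling K L \<T> \<longleftrightarrow>
     morse_tiling K L \<T> \<and>
     (\<exists>N::nat. \<exists>S :: nat \<Rightarrow> 'a set.
        S 0 = {} \<and> S N = relative_space K L \<and>
        (\<forall>j\<le>N. closedin (top_of_set (relative_space K L)) (S j)) \<and>
        (\<forall>j\<in>{1..N}. S (j - 1) \<subseteq> S j \<and> S j - S (j - 1) \<in> \<T>))"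

definition morse_shellable ::
  "'a::euclidean_space set set \<Rightarrow> 'a set set \<Rightarrow> bool" where
  "morse_shellable K L \<longleftrightarrow> (\<exists>\<T>. shellable_tiling K L \<T>)"

definition quiver_vertices :: "nat \<Rightarrow> 'a::euclidean_space set set \<Rightarrow> 'a set set" where
  "quiver_vertices q \<T> = {T \<in> \<T>. tile_order_le T (q + 1)}"

text \<open>The set of arrows of the \<open>q\<close>-quiver, as a relation on \<open>quiver_vertices q \<T>\<close>.\<close>

definition quiver ::
  "nat \<Rightarrow> 'a::euclidean_space set set \<Rightarrow> 'a set set \<Rightarrow> 'a set set \<Rightarrow> ('a set \<times> 'a set) set" where
  "quiver q K L \<T> =
     {(T, T'). T \<in> quiver_vertices q \<T> \<and> T' \<in> quiver_vertices q \<T> \<and> T \<noteq> T' \<and>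
        underlying_simplex T \<inter> T' \<inter> relative_space (skeleton q K) (skeleton q L) \<noteq> {}}"

end

theory Submission
  imports Defs
begin

text \<open>
  Since the quiver is acyclic, its vertices can be listed so that every arrow points to an earlier
  tile. Tiles of order greater than \<open>q + 1\<close> miss the \<open>q\<close>-skeleton, so the trace on the skeleton of
  the union of an initial segment of the list equals the trace of the union of the underlying
  simplices, hence is closed.

  For Morse shellability, the \<open>q\<close>-skeleton of each tile \<open>T\<close> of dimension \<open>n\<close> is cut into Morse tiles
  of dimension \<open>r = min n q\<close>: order the vertices of \<open>T\<close> and assign each open face \<open>\<rho>\<close> to the
  \<open>r\<close>-dimensional face obtained by adding to \<open>\<rho>\<close> the smallest missing vertices. The faces assigned to a
  given one form an interval, which meets \<open>T\<close> in a Morse tile or not at all, and the sum of the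
  vertex indices decreases along the arrows between these pieces. Arrows between pieces of different
  tiles project to arrows of the quiver, so the relation on all pieces is acyclic as well, and the
  first argument applies to it.
\<close>

subsection \<open>Filtrations from acyclic relations\<close>

lemma topological_sort:
  assumes "finite X" and "acyclic (E \<inter> X \<times> X)"
  shows "\<exists>xs. distinct xs \<and> set xs = X \<and>
           (\<forall>i<length xs. \<forall>j<length xs. (xs ! i, xs ! j) \<in> E \<longrightarrow> j < i)"
  using assms
proof (induction "card X" arbitrary: X)
  case 0
  thus ?case by auto
next
  case (Suc c)
  have "wf (E \<inter> X \<times> X)"
    using Suc.prems by (intro finite_acyclic_wf) auto
  moreover have "X \<noteq> {}" using Suc.hyps by auto
  \<comment> \<open>Well-foundedness reads an arrow \<open>(y, x)\<close> as \<open>y\<close> below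
    \<open>x\<close>, so a minimal \<open>x\<close> has no incoming arrow from \<open>X\<close> and
    can come last in the list.\<close>
  ultimately obtain x where x: "x \<in> X" "\<And>y. y \<in> X \<Longrightarrow> (y, x) \<notin> E"
    using wf_eq_minimal[of "E \<inter> X \<times> X"] by blast
  have "acyclic (E \<inter> (X - {x}) \<times> (X - {x}))"
    using Suc.prems(2) by (rule acyclic_subset) auto
  moreover have "c = card (X - {x})" using Suc x by simp
  ultimately obtain xs where xs: "distinct xs" "set xs = X - {x}"
    "\<forall>i<length xs. \<forall>j<length xs. (xs ! i, xs ! j) \<in> E \<longrightarrow> j < i"
    using Suc.hyps(1)[of "X - {x}"] Suc.prems(1) by auto
  have "j < i" if ij: "i < length (xs @ [x])" "j < length (xs @ [x])"
    "((xs @ [x]) ! i, (xs @ [x]) ! j) \<in> E" for i j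
  proof -
    have "set (xs @ [x]) = X" using xs(2) x(1) by auto
    hence "(xs @ [x]) ! i \<in> X" using nth_mem[OF ij(1)] by blast
    hence "(xs @ [x]) ! j \<noteq> x" using x(2) ij(3) by auto
    hence j: "j < length xs" using ij(2) by (auto simp: less_Suc_eq)
    show ?thesis
      using ij j xs(3) by (cases "i = length xs") (auto simp: nth_append less_Suc_eq)
  qed
  thus ?case
    using xs x by (intro exI[of _ "xs @ [x]"]) auto
qed

text \<open>\<open>Q\<close> is only covered by \<open>X\<close>, so that this applies both to whole
  tiles and to pieces filling \<open>Q\<close> exactly. Arrows involve the closure of their source,
  hence the trace on \<open>Q\<close> of an initial segment of a topological sort does not change
  when its members are replaced by their closures, and a finite union of closed sets is
  left.\<close>

lemma filtration_of_acyclic: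
  fixes X :: "'a::topological_space set set"
  assumes "finite X" "disjoint X" "Q \<subseteq> \<Union>X"
    and acyc: "acyclic {(T, T'). T \<in> X \<and> T' \<in> X \<and> T \<noteq> T' \<and> closure T \<inter> T' \<inter> Q \<noteq> {}}"
  shows "\<exists>N::nat. \<exists>S :: nat \<Rightarrow> 'a set. S 0 = {} \<and> S N = \<Union>X \<and>
           (\<forall>j\<le>N. S j \<subseteq> \<Union>X \<and> closedin (top_of_set Q) (S j \<inter> Q)) \<and>
           (\<forall>j\<in>{1..N}. S (j - 1) \<subseteq> S j \<and> S j - S (j - 1) \<in> X)"
proof -
  define E where "E = {(T, T'). T \<in> X \<and> T' \<in> X \<and> T \<noteq> T' \<and> closure T \<inter> T' \<inter> Q \<noteq> {}}"
  have "acyclic (E \<inter> X \<times> X)"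
    using acyc by (rule acyclic_subset) (auto simp: E_def)
  then obtain xs where xs: "distinct xs" "set xs = X"
    "\<And>i j. i < length xs \<Longrightarrow> j < length xs \<Longrightarrow> (xs ! i, xs ! j) \<in> E \<Longrightarrow> j < i"
    using topological_sort[OF \<open>finite X\<close>, of E] by blast
  define S where "S j = (\<Union>i<j. xs ! i)" for j
  have in_X: "xs ! i \<in> X" if "i < length xs" for i
    using that xs(2) nth_mem by auto
  have SN: "S (length xs) = \<Union>X"
    unfolding S_def using xs(2) by (auto simp: set_conv_nth)
  have sub: "S j \<subseteq> \<Union>X" if "j \<le> length xs" for j
    unfolding S_def using that by (intro UN_least Union_upper in_X) auto
  have eq: "S j \<inter> Q = Q \<inter> (\<Union>i<j. closure (xs ! i))" if j: "j \<le> length xs" for j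
  proof
    show "S j \<inter> Q \<subseteq> Q \<inter> (\<Union>i<j. closure (xs ! i))"
      unfolding S_def using closure_subset by blast
    show "Q \<inter> (\<Union>i<j. closure (xs ! i)) \<subseteq> S j \<inter> Q"
    proof safe
      fix x i assume x: "x \<in> Q" "i < j" "x \<in> closure (xs ! i)"
      then obtain l where l: "l < length xs" "x \<in> xs ! l"
        using \<open>Q \<subseteq> \<Union>X\<close> xs(2) by (metis UnionE in_set_conv_nth subsetD)
      have "l \<le> i"
      proof (cases "l = i")
        case False
        hence "xs ! i \<noteq> xs ! l" using xs(1) l x j by (simp add: nth_eq_iff_index_eq)
        hence "(xs ! i, xs ! l) \<in> E"
          unfolding E_def using x l j in_X by auto
        thus ?thesis using xs(3)[of i l] l x j by auto
      qed simp
      thus "x \<in> S j" unfolding S_def using l x by auto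
    qed
  qed
  have "closedin (top_of_set Q) (S j \<inter> Q)" if "j \<le> length xs" for j
    unfolding eq[OF that] by (intro closedin_closed_Int closed_UN) auto
  moreover have "S j - S (j - 1) \<in> X" if j: "j \<in> {1..length xs}" for j
  proof -
    obtain i where i: "j = Suc i" "i < length xs" using j by (cases j) auto
    have "xs ! l \<inter> xs ! i = {}" if "l < i" for l
      using disjointD[OF \<open>disjoint X\<close>, of "xs ! l" "xs ! i"] in_X that i xs(1)
      by (simp add: nth_eq_iff_index_eq)
    hence "S j - S (j - 1) = xs ! i"
      unfolding S_def i by (auto simp: lessThan_Suc)
    thus ?thesis using in_X i by simp
  qed
  moreover have "S (j - 1) \<subseteq> S j" for j unfolding S_def by force
  moreover have "S 0 = {}" unfolding S_def by simp
  ultimately show ?thesis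
    using SN sub by (intro exI[of _ "length xs"] exI[of _ S]) auto
qed

subsection \<open>Minimal completions of finite sets\<close>

text \<open>
  Among the sets \<open>B\<close> of prescribed size with \<open>\<rho> \<subseteq> B \<subseteq> V\<close>, the one of least weight \<open>sum h B\<close> is
  characterised by \<open>upper_part h V B \<subseteq> \<rho>\<close>. Hence the intervals \<open>[upper_part h V B, B]\<close> partition the
  subsets of \<open>V\<close> of at most the prescribed size.
\<close>

definition upper_part :: "('a \<Rightarrow> nat) \<Rightarrow> 'a set \<Rightarrow> 'a set \<Rightarrow> 'a set" where
  "upper_part h V B = {b \<in> B. \<exists>v\<in>V - B. h v < h b}"

text \<open>An element of \<open>B\<close> outside the upper part has a smaller value of
  \<open>h\<close> than every element of \<open>V - B\<close>. This applies to all of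
  \<open>B - B'\<close>, so any bijection from \<open>B - B'\<close> onto \<open>B' - B\<close>
  strictly increases \<open>h\<close>.\<close>

lemma completion_sum_less:
  fixes h :: "'a \<Rightarrow> nat"
  assumes "finite V" "inj_on h V" "B \<subseteq> V" "B' \<subseteq> V" "card B' = card B" "B' \<noteq> B"
    and "upper_part h V B \<subseteq> \<rho>" "\<rho> \<subseteq> B'"
  shows "sum h B < sum h B'"
proof -
  have fin: "finite B" "finite B'" using assms finite_subset by blast+
  have card: "card (B - B') = card (B' - B)"
    using card_Diff_subset_Int[of B B'] card_Diff_subset_Int[of B' B] fin assms(5)
    by (simp add: Int_commute)
  have ne: "B - B' \<noteq> {}"
    using assms(5,6) fin by (metis Diff_eq_empty_iff card_subset_eq)
  have lt: "h b < h v" if "b \<in> B - B'" "v \<in> B' - B" for b v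
  proof -
    have "b \<notin> upper_part h V B" using that assms by blast
    hence "h b \<le> h v" unfolding upper_part_def using that assms(4) by force
    moreover have "h b \<noteq> h v" using that assms(2-4) by (metis DiffD1 DiffD2 inj_onD subsetD)
    ultimately show ?thesis by simp
  qed
  obtain f where f: "bij_betw f (B - B') (B' - B)"
    using finite_same_card_bij[of "B - B'" "B' - B"] card fin by auto
  have "sum h (B - B') < sum (\<lambda>b. h (f b)) (B - B')"
    using fin ne lt bij_betwE[OF f] by (intro sum_strict_mono) auto
  also have "\<dots> = sum h (B' - B)"
    using sum.reindex_bij_betw[OF f] by simp
  finally show ?thesis
    using sum.Int_Diff[OF fin(1), of h B'] sum.Int_Diff[OF fin(2), of h B]
    by (simp add: Int_commute)
qed

text \<open>A completion of least weight works: an element of its upper part outside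
  \<open>\<rho>\<close> could be exchanged for a missing element with a smaller value of
  \<open>h\<close>.\<close>

lemma completion_exists:
  fixes h :: "'a \<Rightarrow> nat"
  assumes "finite V" "\<rho> \<subseteq> V" "card \<rho> \<le> r" "r \<le> card V"
  shows "\<exists>B. \<rho> \<subseteq> B \<and> B \<subseteq> V \<and> card B = r \<and> upper_part h V B \<subseteq> \<rho>"
proof -
  define P where "P B \<longleftrightarrow> \<rho> \<subseteq> B \<and> B \<subseteq> V \<and> card B = r" for B
  have "\<exists>B. P B"
    unfolding P_def using exists_subset_between[OF assms(3,4,2,1)] by blast
  then obtain B where B: "P B" and min: "\<And>B'. P B' \<Longrightarrow> sum h B \<le> sum h B'"
    using ex_has_least_nat[of P _ "sum h"] by blast
  have fin: "finite B" using B assms(1) finite_subset unfolding P_def by blast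
  have "upper_part h V B \<subseteq> \<rho>"
  proof
    fix b assume "b \<in> upper_part h V B"
    then obtain v where v: "b \<in> B" "v \<in> V - B" "h v < h b" unfolding upper_part_def by blast
    show "b \<in> \<rho>"
    proof (rule ccontr)
      assume "b \<notin> \<rho>"
      hence "P (insert v (B - {b}))"
        using B v fin card_Suc_Diff1[OF fin v(1)] unfolding P_def by auto
      from min[OF this] have "sum h B \<le> h v + sum h (B - {b})" using v fin by simp
      moreover have "sum h B = h b + sum h (B - {b})" using v fin by (simp add: sum.remove)
      ultimately show False using v(3) by simp
    qed
  qed
  thus ?thesis using B unfolding P_def by blast
qed

subsection \<open>Morse tiles in terms of supports\<close>

text \<open>
  For affinely independent \<open>V\<close> this is the vertex set of the open face of \<open>convex hull V\<close>
  containing \<open>x\<close>; for \<open>x\<close> outside \<open>convex hull V\<close> it is the junk value \<open>UNIV\<close>.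
\<close>

definition supp :: "'a::euclidean_space set \<Rightarrow> 'a \<Rightarrow> 'a set" where
  "supp V x = \<Inter>{B. B \<subseteq> V \<and> x \<in> convex hull B}"

lemma supp_least: "B \<subseteq> V \<Longrightarrow> x \<in> convex hull B \<Longrightarrow> supp V x \<subseteq> B"
  unfolding supp_def by blast

text \<open>Affine independence makes convex hulls commute with intersections, so the intersection
  of all candidates is itself a candidate.\<close>

lemma in_hull_supp:
  assumes "\<not> affine_dependent V" "x \<in> convex hull V"
  shows "x \<in> convex hull (supp V x)"
proof -
  have "\<Union>{B. B \<subseteq> V \<and> x \<in> convex hull B} = V" using assms by blast
  thus ?thesis
    unfolding supp_def using assms convex_hull_Inter[of "{B. B \<subseteq> V \<and> x \<in> convex hull B}"] by simp
qed

lemma in_hull_iff: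
  assumes "\<not> affine_dependent V" "B \<subseteq> V"
  shows "x \<in> convex hull B \<longleftrightarrow> x \<in> convex hull V \<and> supp V x \<subseteq> B"
proof
  assume "x \<in> convex hull B"
  thus "x \<in> convex hull V \<and> supp V x \<subseteq> B"
    using supp_least[OF assms(2)] hull_mono[OF assms(2)] by blast
next
  assume "x \<in> convex hull V \<and> supp V x \<subseteq> B"
  thus "x \<in> convex hull B"
    using in_hull_supp[OF assms(1)] hull_mono[of "supp V x" B] by blast
qed

text \<open>Each of the two supports is a candidate in the definition of the other. Points described
  in different faces can thus be compared inside one simplex.\<close>

lemma supp_eq_of_subset:
  assumes "\<not> affine_dependent V" "B \<subseteq> V" "x \<in> convex hull B"
  shows "supp B x = supp V x"
proof
  have V: "x \<in> convex hull V" using assms hull_mono by blast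
  have B: "\<not> affine_dependent B" using assms affine_independent_subset by blast
  show "supp B x \<subseteq> supp V x"
    using supp_least[OF assms(2,3)] in_hull_supp[OF assms(1) V] by (rule supp_least)
  show "supp V x \<subseteq> supp B x"
    using supp_least[OF subset_refl assms(3)] assms(2) in_hull_supp[OF B assms(3)]
    by (meson order_trans supp_least)
qed

lemma supp_vertex:
  assumes "\<not> affine_dependent V" "v \<in> V"
  shows "supp V v = {v}"
proof -
  have "supp V v \<subseteq> {v}" using assms by (intro supp_least) auto
  moreover have "supp V v \<noteq> {}"
    using in_hull_supp[OF assms(1), of v] assms(2) by (auto simp: hull_inc)
  ultimately show ?thesis by blast
qed

text \<open>The hull of the support is a face meeting the relative interior, hence the whole
  simplex. A vertex lying in it belongs to the support, since the support of a vertex is that vertex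
  alone.\<close>

lemma supp_rel_interior:
  assumes "\<not> affine_dependent V" "x \<in> rel_interior (convex hull V)"
  shows "supp V x = V"
proof
  have x: "x \<in> convex hull V" using assms rel_interior_subset by blast
  show sub: "supp V x \<subseteq> V" using x by (intro supp_least) auto
  have "convex hull (supp V x) face_of convex hull V"
    using face_of_convex_hull_affine_independent[OF assms(1)] sub by blast
  hence sub2: "convex hull V \<subseteq> convex hull (supp V x)"
    using in_hull_supp[OF assms(1) x] assms(2) by (blast dest: subset_of_face_of[OF _ subset_refl])
  show "V \<subseteq> supp V x"
  proof
    fix v assume v: "v \<in> V"
    hence "v \<in> convex hull (supp V x)"
      using sub2 hull_inc[OF v] by blast
    thus "v \<in> supp V x"
      using in_hull_iff[OF assms(1) sub] supp_vertex[OF assms(1) v] by simp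
  qed
qed

lemma aff_dim_hull_independent:
  "\<not> affine_dependent V \<Longrightarrow> aff_dim (convex hull V) = int (card V) - 1"
  using aff_dim_affine_independent[of V] by (simp add: aff_dim_convex_hull)

text \<open>Faces are spanned by subsets of \<open>V\<close>, and codimension one means that one
  vertex is missing. The case \<open>n = 0\<close> is included: the empty hull has dimension
  \<open>- 1\<close>.\<close>

lemma codim_one_faces:
  assumes "\<not> affine_dependent V" "card V = Suc n"
  shows "{F. F face_of convex hull V \<and> aff_dim F = int n - 1} = (\<lambda>v. convex hull (V - {v})) ` V"
proof -
  have fin: "finite V" using assms(1) by (rule aff_independent_finite)
  have dim: "aff_dim (convex hull c) = int n - 1 \<longleftrightarrow> card c = n" if "c \<subseteq> V" for c
    using aff_dim_hull_independent[OF affine_independent_subset[OF assms(1) that]] by simp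
  have 1: "\<exists>v\<in>V. c = V - {v}" if "c \<subseteq> V" "card c = n" for c
  proof -
    have "card (V - c) = 1"
      using that fin assms(2) by (simp add: card_Diff_subset finite_subset)
    then obtain v where "V - c = {v}" by (auto simp: card_1_singleton_iff)
    hence "v \<in> V" "c = V - {v}" using that(1) by auto
    thus ?thesis by blast
  qed
  have 2: "card (V - {v}) = n" if "v \<in> V" for v
    using that fin assms(2) by simp
  have "F face_of convex hull V \<and> aff_dim F = int n - 1 \<longleftrightarrow>
      (\<exists>c. c \<subseteq> V \<and> card c = n \<and> F = convex hull c)" for F
    unfolding face_of_convex_hull_affine_independent[OF assms(1)] using dim by metis
  moreover have "(\<exists>c. c \<subseteq> V \<and> card c = n \<and> F = convex hull c) \<longleftrightarrow>
      (\<exists>v\<in>V. F = convex hull (V - {v}))" for F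
    using 1 2 Diff_subset by metis
  ultimately show ?thesis by (simp add: image_def)
qed

text \<open>\<open>D\<close> lists the vertices opposite to the removed codimension one faces: a
  point of the simplex avoids the face opposite to \<open>v\<close> iff \<open>v\<close> is in its
  support. \<open>M\<close> spans the Morse face. Tiles become conditions on supports, and the same
  \<open>M\<close> serves for every face of \<open>V\<close>.\<close>

definition support_tile :: "'a::euclidean_space set \<Rightarrow> 'a set \<Rightarrow> 'a set \<Rightarrow> 'a set" where
  "support_tile V D M = {x \<in> convex hull V. D \<subseteq> supp V x \<and> \<not> supp V x \<subseteq> M}"

lemma support_tile_eq_Diff:
  assumes "\<not> affine_dependent V" "D \<subseteq> V" "M \<subseteq> V"
  shows "support_tile V D M =
    convex hull V - ((\<Union>v\<in>D. convex hull (V - {v})) \<union> convex hull M)"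
proof -
  have "supp V x \<subseteq> V" if "x \<in> convex hull V" for x using that by (intro supp_least) auto
  thus ?thesis
    using in_hull_iff[OF assms(1,3)] in_hull_iff[OF assms(1), of "V - {v}" for v]
    unfolding support_tile_def by auto (blast+)
qed

lemma morse_tile_imp_support_tile:
  assumes "morse_tile \<sigma> n k T"
  shows "\<exists>V D M. \<not> affine_dependent V \<and> card V = Suc n \<and> \<sigma> = convex hull V \<and>
           card D = k \<and> T = support_tile V D M"
proof -
  from assms obtain V A \<mu> where V: "\<not> affine_dependent V" "card V = Suc n" "\<sigma> = convex hull V"
    and A: "A \<subseteq> {F. F face_of \<sigma> \<and> aff_dim F = int n - 1}" "card A = k"
    and \<mu>: "\<mu> face_of \<sigma>" and T: "T = \<sigma> - (\<Union>A \<union> \<mu>)"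
    unfolding morse_tile_def simplex_def by force
  obtain M where M: "M \<subseteq> V" "\<mu> = convex hull M"
    using \<mu> V face_of_convex_hull_affine_independent by blast
  \<comment> \<open>One opposite vertex is chosen for each removed face, so \<open>card D\<close> is
    exactly the order.\<close>
  obtain D where D: "D \<subseteq> V" "inj_on (\<lambda>v. convex hull (V - {v})) D"
    "A = (\<lambda>v. convex hull (V - {v})) ` D"
    using A(1) unfolding V(3) codim_one_faces[OF V(1,2)] subset_image_inj by blast
  have "card D = k" using D A(2) by (simp add: card_image)
  moreover have "T = support_tile V D M"
    using support_tile_eq_Diff[OF V(1) D(1) M(1)] T V(3) D(3) M(2) by simp
  ultimately show ?thesis using V by (intro exI[of _ V] exI[of _ D] exI[of _ M]) simp
qed

text \<open>
  The face on \<open>B \<inter> M\<close> need not be a legitimate Morse face: it is already removed if \<open>D\<close> is not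
  contained in \<open>M\<close>, and it is one more removed codimension one face if \<open>B - M\<close> is a singleton.
\<close>

lemma support_tile_imp_morse_tile:
  assumes B: "\<not> affine_dependent B" "card B = Suc m" and ne: "support_tile B D M \<noteq> {}"
  shows "\<exists>k. morse_tile (convex hull B) m k (support_tile B D M)"
proof -
  have fin: "finite B" using B aff_independent_finite by blast
  have sB: "supp B x \<subseteq> B" if "x \<in> convex hull B" for x using that by (intro supp_least) auto
  have DB: "D \<subseteq> B" using ne sB unfolding support_tile_def by blast
  have BM: "\<not> B \<subseteq> M" using ne sB unfolding support_tile_def by blast
  have simplex: "int m simplex convex hull B" using B unfolding simplex_def by auto
  have tile: "\<exists>k. morse_tile (convex hull B) m k (support_tile B D' M')"
    if D': "D' \<subseteq> B" and M': "M' \<subseteq> B" "M' = {} \<or> card M' < m \<and> D' \<subseteq> M'" for D' M'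
  proof -
    let ?A = "(\<lambda>v. convex hull (B - {v})) ` D'"
    \<comment> \<open>A relative interior point of the Morse face has support \<open>M'\<close>,
      which contains \<open>D'\<close>, so it lies in none of the removed codimension one
      faces.\<close>
    have "\<not> convex hull M' \<subseteq> \<Union>?A" if "M' \<noteq> {}"
    proof -
      have iM: "\<not> affine_dependent M'" using affine_independent_subset B(1) M'(1) .
      have "rel_interior (convex hull M') \<noteq> {}" using that by (simp add: rel_interior_eq_empty)
      then obtain x where x: "x \<in> rel_interior (convex hull M')" by blast
      have xM: "x \<in> convex hull M'" using x rel_interior_subset by blast
      have "supp B x = M'"
        using supp_rel_interior[OF iM x] supp_eq_of_subset[OF B(1) M'(1) xM] by simp
      hence "x \<notin> convex hull (B - {v})" if "v \<in> D'" for v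
        using that M'(2) \<open>M' \<noteq> {}\<close> in_hull_iff[OF B(1), of "B - {v}" x] by auto
      thus ?thesis using xM by blast
    qed
    moreover have "aff_dim (convex hull M') = int (card M') - 1"
      using aff_dim_hull_independent affine_independent_subset[OF B(1) M'(1)] by blast
    moreover have "?A \<subseteq> {F. F face_of convex hull B \<and> aff_dim F = int m - 1}"
      using codim_one_faces[OF B] D' by blast
    moreover have "convex hull M' face_of convex hull B"
      using face_of_convex_hull_affine_independent[OF B(1)] M'(1) by blast
    ultimately have "morse_tile (convex hull B) m (card ?A) (support_tile B D' M')"
      unfolding morse_tile_def support_tile_eq_Diff[OF B(1) D' M'(1)]
      using simplex M'(2) by (intro conjI exI[of _ ?A] exI[of _ "convex hull M'"]) auto
    thus ?thesis by blast
  qed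
  consider "\<not> D \<subseteq> M" | u where "B - M = {u}" "D \<subseteq> M" | "D \<subseteq> M" "card (B - M) \<ge> 2"
  proof -
    have "card (B - M) \<noteq> 0" using BM fin by auto
    hence "card (B - M) = 1 \<or> card (B - M) \<ge> 2" by linarith
    thus ?thesis using that by (auto simp: card_1_singleton_iff)
  qed
  thus ?thesis
  proof cases
    case 1
    hence "support_tile B D M = support_tile B D {}"
      unfolding support_tile_def by blast
    thus ?thesis using tile[of D "{}"] DB by simp
  next
    case 2
    have "\<not> supp B x \<subseteq> M \<longleftrightarrow> u \<in> supp B x" if "x \<in> convex hull B" for x
    proof -
      have "y \<notin> M \<longleftrightarrow> y = u" if "y \<in> B" for y using that 2(1) by blast
      moreover have "u \<in> B" using 2(1) by blast
      ultimately show ?thesis using sB[OF that] by blast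
    qed
    hence "support_tile B D M = support_tile B (insert u D) {}"
      unfolding support_tile_def by auto
    thus ?thesis using tile[of "insert u D" "{}"] DB 2(1) by auto
  next
    case 3
    \<comment> \<open>As \<open>card B = m + 1\<close>, two missing vertices are exactly what
      codimension greater than one demands.\<close>
    have "card (B \<inter> M) < m"
      using 3(2) card_Diff_subset_Int[of B M] B(2) fin by simp
    moreover have "support_tile B D M = support_tile B D (B \<inter> M)"
      unfolding support_tile_def using sB by auto
    ultimately show ?thesis using tile[of D "B \<inter> M"] DB 3(1) by auto
  qed
qed

subsection \<open>Skeleta of Morse tiles\<close>

text \<open>\<open>piece B\<close> collects the points of the tile whose support has minimal
  completion \<open>B\<close>. The condition on the upper part merely enlarges \<open>D\<close>, so
  a piece is again a support tile, now on \<open>B\<close>. Strict comparison of sums gives both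
  disjointness and the decrease of \<open>w\<close>.\<close>

lemma support_tile_pieces:
  assumes V: "\<not> affine_dependent V" "card V = Suc n"
  shows "\<exists>P. \<exists>w :: 'a::euclidean_space set \<Rightarrow> nat.
    finite P \<and> disjoint P \<and> {} \<notin> P \<and>
    \<Union>P = {x \<in> support_tile V D M. card (supp V x) \<le> Suc q} \<and>
    (\<forall>p\<in>P. \<exists>B k. B \<subseteq> V \<and> card B = Suc (min n q) \<and> morse_tile (convex hull B) (min n q) k p) \<and>
    (\<forall>p\<in>P. \<forall>p'\<in>P. p \<noteq> p' \<and> closure p \<inter> p' \<noteq> {} \<longrightarrow> w p' < w p)"
proof -
  have fin: "finite V" using V(1) by (rule aff_independent_finite)
  obtain h :: "'a \<Rightarrow> nat" where h: "inj_on h V"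
    using finite_imp_inj_to_nat_seg[OF fin] by blast
  \<comment> \<open>\<open>r\<close> counts vertices, one more than the dimension
    \<open>min n q\<close> of the pieces.\<close>
  define r where "r = Suc (min n q)"
  define \<B> where "\<B> = {B. B \<subseteq> V \<and> card B = r}"
  define piece where "piece B = support_tile B (D \<union> upper_part h V B) M" for B
  define P where "P = piece ` \<B> - {{}}"
  \<comment> \<open>The weight has to depend on the piece as a set; intersecting the closure of a
    non-empty piece with \<open>V\<close> recovers its index \<open>B\<close>.\<close>
  define w where "w p = sum h (V \<inter> closure p)" for p :: "'a set"
  have indep: "\<not> affine_dependent B" if "B \<in> \<B>" for B
    using that V(1) affine_independent_subset unfolding \<B>_def by blast
  have mem: "x \<in> piece B \<longleftrightarrow>
      x \<in> support_tile V D M \<and> upper_part h V B \<subseteq> supp V x \<and> supp V x \<subseteq> B"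
    if B: "B \<in> \<B>" for B x
  proof -
    have "B \<subseteq> V" using B by (simp add: \<B>_def)
    thus ?thesis
      using in_hull_iff[OF V(1) \<open>B \<subseteq> V\<close>, of x] supp_eq_of_subset[OF V(1) \<open>B \<subseteq> V\<close>, of x]
      unfolding piece_def support_tile_def by auto
  qed
  have fin_P: "finite P" unfolding P_def \<B>_def using fin by simp
  have tile: "\<exists>k. morse_tile (convex hull B) (min n q) k (piece B)"
    if "B \<in> \<B>" "piece B \<noteq> {}" for B
    using that support_tile_imp_morse_tile[OF indep[OF that(1)], of "min n q"]
    unfolding piece_def \<B>_def r_def by blast
  \<comment> \<open>It is enough that \<open>x\<close> lies in the closed simplex on
    \<open>B\<close>, which is what an arrow between pieces provides. Disjointness follows by
    applying this in both directions.\<close>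
  have less: "sum h B' < sum h B"
    if BB: "B \<in> \<B>" "B' \<in> \<B>" "B \<noteq> B'" and x: "x \<in> convex hull B" "x \<in> piece B'" for B B' x
  proof (rule completion_sum_less[OF fin h])
    show "supp V x \<subseteq> B" using x(1) BB(1) by (intro supp_least) (auto simp: \<B>_def)
    show "upper_part h V B' \<subseteq> supp V x" using x(2) mem[OF BB(2)] by blast
  qed (use BB in \<open>auto simp: \<B>_def\<close>)
  have sub_hull: "x \<in> convex hull B" if "x \<in> piece B" for x B
    using that unfolding piece_def support_tile_def by blast
  have "disjoint P"
  proof (rule disjointI)
    fix p p' assume p: "p \<in> P" "p' \<in> P" "p \<noteq> p'"
    then obtain B B' where B: "B \<in> \<B>" "p = piece B" "B' \<in> \<B>" "p' = piece B'"
      unfolding P_def by blast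
    hence "B \<noteq> B'" using p by blast
    show "p \<inter> p' = {}"
    proof (rule ccontr)
      assume "p \<inter> p' \<noteq> {}"
      then obtain x where x: "x \<in> piece B" "x \<in> piece B'" using B by blast
      have "sum h B' < sum h B" "sum h B < sum h B'"
        using less[OF B(1,3) \<open>B \<noteq> B'\<close> sub_hull[OF x(1)] x(2)]
          less[OF B(3,1) \<open>B \<noteq> B'\<close>[symmetric] sub_hull[OF x(2)] x(1)] .
      thus False by simp
    qed
  qed
  moreover have "\<Union>P = {x \<in> support_tile V D M. card (supp V x) \<le> Suc q}"
  proof (intro equalityI subsetI)
    fix x assume "x \<in> \<Union>P"
    then obtain B where B: "B \<in> \<B>" "x \<in> piece B" unfolding P_def by blast
    have "finite B" using B(1) fin finite_subset unfolding \<B>_def by blast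
    hence "card (supp V x) \<le> card B" using B mem card_mono[OF \<open>finite B\<close>] by blast
    also have "\<dots> \<le> Suc q" using B(1) unfolding \<B>_def r_def by simp
    finally show "x \<in> {x \<in> support_tile V D M. card (supp V x) \<le> Suc q}"
      using B mem by blast
  next
    fix x assume "x \<in> {x \<in> support_tile V D M. card (supp V x) \<le> Suc q}"
    hence x: "x \<in> support_tile V D M" "card (supp V x) \<le> Suc q" by auto
    have sub: "supp V x \<subseteq> V"
      using x(1) unfolding support_tile_def by (intro supp_least) auto
    hence "card (supp V x) \<le> r" using x(2) card_mono[OF fin sub] V(2) unfolding r_def by simp
    then obtain B where "supp V x \<subseteq> B" "B \<in> \<B>" "upper_part h V B \<subseteq> supp V x"
      using completion_exists[OF fin sub, of r h] V(2) unfolding \<B>_def r_def by auto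
    hence "B \<in> \<B>" "x \<in> piece B" using mem x(1) by auto
    thus "x \<in> \<Union>P" unfolding P_def by blast
  qed
  moreover have "\<exists>B k. B \<subseteq> V \<and> card B = Suc (min n q) \<and> morse_tile (convex hull B) (min n q) k p"
    if p: "p \<in> P" for p
  proof -
    from p obtain B where "B \<in> \<B>" "p = piece B" "p \<noteq> {}" unfolding P_def by blast
    thus ?thesis using tile[of B] unfolding \<B>_def r_def by blast
  qed
  moreover have "w p' < w p" if p: "p \<in> P" "p' \<in> P" "p \<noteq> p'" "closure p \<inter> p' \<noteq> {}" for p p'
  proof -
    from p obtain B B' where B: "B \<in> \<B>" "p = piece B" "B' \<in> \<B>" "p' = piece B'"
      and ne: "p \<noteq> {}" "p' \<noteq> {}"
      unfolding P_def by blast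
    have w: "w (piece C) = sum h C" "closure (piece C) = convex hull C"
      if C: "C \<in> \<B>" "piece C \<noteq> {}" for C
    proof -
      show eq: "closure (piece C) = convex hull C"
        using tile[OF C] morse_tile_closure by blast
      have "C \<subseteq> V" using C(1) unfolding \<B>_def by simp
      hence "v \<in> convex hull C \<longleftrightarrow> v \<in> C" if "v \<in> V" for v
        using in_hull_iff[OF V(1), of C v] supp_vertex[OF V(1) that] hull_inc[OF that] by simp
      hence "V \<inter> convex hull C = C" using \<open>C \<subseteq> V\<close> by blast
      thus "w (piece C) = sum h C" unfolding w_def eq by simp
    qed
    obtain x where "x \<in> convex hull B" "x \<in> piece B'"
      using p(4) B w(2) ne by blast
    hence "sum h B' < sum h B" using less B p(3) by blast
    thus ?thesis using w(1) B ne by simp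
  qed
  moreover have "{} \<notin> P" unfolding P_def by simp
  ultimately show ?thesis using fin_P by (intro exI[of _ P] exI[of _ w]) simp
qed

section \<open>Skeleta of relative complexes and supports of their points\<close>

lemma relative_space_skeleton_subset:
  "relative_space (skeleton q K) (skeleton q L) \<subseteq> relative_space K L"
  unfolding relative_space_def skeleton_def by blast

lemma relative_simplicial_complex_skeleton:
  assumes "relative_simplicial_complex K L"
  shows "relative_simplicial_complex (skeleton q K) (skeleton q L)"
proof -
  have "simplicial_complex (skeleton q C)" if C: "simplicial_complex C" for C :: "'a set set"
  proof -
    have "aff_dim F \<le> int q" if "F face_of S" "aff_dim S \<le> int q" for F S :: "'a set"
      using that aff_dim_subset[OF face_of_imp_subset] by (meson order_trans)
    thus ?thesis using C unfolding simplicial_complex_def skeleton_def by auto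
  qed
  thus ?thesis using assms unfolding relative_simplicial_complex_def skeleton_def by auto
qed

text \<open>The common face of \<open>\<tau>\<close> and \<open>convex hull V\<close> meets the
  relative interior of \<open>\<tau>\<close>, so it is all of \<open>\<tau>\<close>. Thus
  \<open>\<tau>\<close> is a face of \<open>convex hull V\<close>, and its vertex set is
  \<open>supp V x\<close>.\<close>

lemma aff_dim_carrier_simplex:
  assumes K: "simplicial_complex K" "\<tau> \<in> K" "convex hull V \<in> K"
    and V: "\<not> affine_dependent V" and x: "x \<in> rel_interior \<tau>" "x \<in> convex hull V"
  shows "aff_dim \<tau> = int (card (supp V x)) - 1"
proof -
  have "(\<tau> \<inter> convex hull V) face_of \<tau>" "(convex hull V \<inter> \<tau>) face_of convex hull V"
    using K unfolding simplicial_complex_def by blast+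
  moreover have "\<tau> \<subseteq> \<tau> \<inter> convex hull V"
    using calculation(1) x rel_interior_subset by (intro subset_of_face_of[OF _ subset_refl]) auto
  ultimately have "\<tau> face_of convex hull V" by (simp add: Int_absorb1)
  then obtain B where B: "B \<subseteq> V" "\<tau> = convex hull B"
    using face_of_convex_hull_affine_independent[OF V] by blast
  have iB: "\<not> affine_dependent B" using affine_independent_subset V B(1) .
  have "x \<in> convex hull B" using x(1) rel_interior_subset B(2) by blast
  hence "supp V x = B"
    using supp_rel_interior[OF iB x(1)[unfolded B(2)]] supp_eq_of_subset[OF V B(1)] by simp
  thus ?thesis using aff_dim_hull_independent[OF iB] B(2) by simp
qed

text \<open>All open simplices of \<open>K\<close> through \<open>x\<close> have the dimension given
  by the support, and one of them comes from a simplex outside \<open>L\<close>.\<close>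

lemma mem_skeleton_iff:
  assumes "relative_simplicial_complex K L" "x \<in> relative_space K L"
    and V: "\<not> affine_dependent V" "convex hull V \<in> K" "x \<in> convex hull V"
  shows "x \<in> relative_space (skeleton q K) (skeleton q L) \<longleftrightarrow> card (supp V x) \<le> Suc q"
proof -
  have K: "simplicial_complex K" using assms(1) unfolding relative_simplicial_complex_def by blast
  have dim: "aff_dim \<tau> \<le> int q \<longleftrightarrow> card (supp V x) \<le> Suc q"
    if "\<tau> \<in> K" "x \<in> rel_interior \<tau>" for \<tau>
    using aff_dim_carrier_simplex[OF K that(1) V(2,1) that(2) V(3)] by linarith
  obtain \<tau> where "\<tau> \<in> K - L" "x \<in> rel_interior \<tau>"
    using assms(2) unfolding relative_space_def by blast
  thus ?thesis
    using dim unfolding relative_space_def skeleton_def by auto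
qed

text \<open>The support of a point of \<open>T\<close> contains the \<open>k\<close> vertices of
  \<open>D\<close>, while that of a point of the skeleton has at most \<open>q + 1\<close> elements.
  This explains the bound in the definition of the quiver.\<close>

lemma tile_order_le_of_meets_skeleton:
  assumes "relative_simplicial_complex K L" "T \<subseteq> relative_space K L"
    and T: "morse_tile \<sigma> n k T" "\<sigma> \<in> K"
    and x: "x \<in> T" "x \<in> relative_space (skeleton q K) (skeleton q L)"
  shows "tile_order_le T (q + 1)"
proof -
  obtain V D M where V: "\<not> affine_dependent V" "\<sigma> = convex hull V" "card D = k"
    "T = support_tile V D M"
    using morse_tile_imp_support_tile[OF T(1)] by blast
  have x': "x \<in> convex hull V" "D \<subseteq> supp V x"
    using x(1) unfolding V(4) support_tile_def by auto
  have "finite (supp V x)"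
    using supp_least[OF subset_refl x'(1)] aff_independent_finite[OF V(1)] finite_subset by blast
  hence "k \<le> card (supp V x)" using x'(2) card_mono V(3) by blast
  moreover have "card (supp V x) \<le> Suc q"
    using mem_skeleton_iff[OF assms(1) _ V(1) _ x'(1)] x assms(2) T(2) V(2) by blast
  ultimately show ?thesis unfolding tile_order_le_def using T(1) by force
qed

lemma skeleton_of_tile:
  assumes "relative_simplicial_complex K L" "T \<subseteq> relative_space K L"
    and T: "morse_tile \<sigma> n k T" "\<sigma> \<in> K"
  shows "\<exists>P. \<exists>w :: 'a::euclidean_space set \<Rightarrow> nat.
    finite P \<and> disjoint P \<and> {} \<notin> P \<and>
    \<Union>P = T \<inter> relative_space (skeleton q K) (skeleton q L) \<and>
    (\<forall>p\<in>P. \<exists>\<tau>\<in>skeleton q K. \<exists>l. \<tau> \<subseteq> \<sigma> \<and> morse_tile \<tau> (min n q) l p) \<and>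
    (\<forall>p\<in>P. \<forall>p'\<in>P. p \<noteq> p' \<and> closure p \<inter> p' \<noteq> {} \<longrightarrow> w p' < w p)"
proof -
  obtain V D M where V: "\<not> affine_dependent V" "card V = Suc n" "\<sigma> = convex hull V"
    "T = support_tile V D M"
    using morse_tile_imp_support_tile[OF T(1)] by blast
  have eq: "{x \<in> support_tile V D M. card (supp V x) \<le> Suc q} =
      T \<inter> relative_space (skeleton q K) (skeleton q L)"
  proof -
    have "card (supp V x) \<le> Suc q \<longleftrightarrow> x \<in> relative_space (skeleton q K) (skeleton q L)"
      if "x \<in> T" for x
    proof -
      have "x \<in> convex hull V" using that unfolding V(4) support_tile_def by blast
      thus ?thesis
        using mem_skeleton_iff[OF assms(1) _ V(1)] that assms(2) T(2) V(3) by blast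
    qed
    thus ?thesis using V(4) by blast
  qed
  have face: "convex hull B \<in> skeleton q K \<and> convex hull B \<subseteq> \<sigma>"
    if B: "B \<subseteq> V" "card B = Suc (min n q)" for B
  proof -
    have "convex hull B face_of \<sigma>"
      using face_of_convex_hull_affine_independent[OF V(1)] B(1) V(3) by blast
    hence "convex hull B \<in> K" "convex hull B \<subseteq> \<sigma>"
      using assms(1) T(2) face_of_imp_subset
      unfolding relative_simplicial_complex_def simplicial_complex_def by blast+
    moreover have "aff_dim (convex hull B) \<le> int q"
      using aff_dim_hull_independent[OF affine_independent_subset[OF V(1) B(1)]] B(2) by simp
    ultimately show ?thesis unfolding skeleton_def by blast
  qed
  obtain P and w :: "'a set \<Rightarrow> nat" where P: "finite P" "disjoint P" "{} \<notin> P"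
    "\<Union>P = {x \<in> support_tile V D M. card (supp V x) \<le> Suc q}"
    "\<forall>p\<in>P. \<exists>B k. B \<subseteq> V \<and> card B = Suc (min n q) \<and> morse_tile (convex hull B) (min n q) k p"
    "\<forall>p\<in>P. \<forall>p'\<in>P. p \<noteq> p' \<and> closure p \<inter> p' \<noteq> {} \<longrightarrow> w p' < w p"
    using support_tile_pieces[OF V(1,2), where D = D and M = M and q = q]
    by (elim exE conjE) (rule that, assumption+)
  have "\<exists>\<tau>\<in>skeleton q K. \<exists>l. \<tau> \<subseteq> \<sigma> \<and> morse_tile \<tau> (min n q) l p" if "p \<in> P" for p
    using P(5) that face by meson
  thus ?thesis
    using P(1-4,6) eq by (intro exI[of _ P] exI[of _ w]) simp
qed

text \<open>A tile is determined by its simplex, a set of faces and a Morse face, and a polytope has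
  finitely many faces.\<close>

lemma finite_morse_tiling:
  assumes "morse_tiling K L \<T>"
  shows "finite \<T>"
proof -
  have K: "simplicial_complex K" and T: "\<forall>T\<in>\<T>. \<exists>\<sigma>\<in>K. \<exists>n k. morse_tile \<sigma> n k T"
    using assms unfolding morse_tiling_def relative_simplicial_complex_def by auto
  have "finite {F. F face_of \<sigma>}" if "\<sigma> \<in> K" for \<sigma>
    using K that simplex_imp_polytope finite_polytope_faces unfolding simplicial_complex_def by blast
  hence "finite (\<Union>\<sigma>\<in>K. (\<lambda>(A, \<mu>). \<sigma> - (\<Union>A \<union> \<mu>)) ` (Pow {F. F face_of \<sigma>} \<times> {F. F face_of \<sigma>}))"
    using K unfolding simplicial_complex_def by auto
  moreover have "\<T> \<subseteq> (\<Union>\<sigma>\<in>K. (\<lambda>(A, \<mu>). \<sigma> - (\<Union>A \<union> \<mu>)) ` (Pow {F. F face_of \<sigma>} \<times> {F. F face_of \<sigma>}))"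
  proof
    fix T assume "T \<in> \<T>"
    then obtain \<sigma> n k where \<sigma>: "\<sigma> \<in> K" "morse_tile \<sigma> n k T" using T by blast
    then obtain A \<mu> where "A \<subseteq> {F. F face_of \<sigma> \<and> aff_dim F = int n - 1}"
      "\<mu> face_of \<sigma>" "T = \<sigma> - (\<Union>A \<union> \<mu>)"
      unfolding morse_tile_def by blast
    thus "T \<in> (\<Union>\<sigma>\<in>K. (\<lambda>(A, \<mu>). \<sigma> - (\<Union>A \<union> \<mu>)) ` (Pow {F. F face_of \<sigma>} \<times> {F. F face_of \<sigma>}))"
      using \<sigma>(1) by (intro UN_I[of \<sigma>] image_eqI[of _ _ "(A, \<mu>)"]) auto
  qed
  ultimately show ?thesis by (rule rev_finite_subset)
qed

theorem theorem3p15: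
  fixes q :: nat and K L \<T> :: "'a::euclidean_space set set"
  assumes "relative_simplicial_complex K L"
    and "morse_tiling K L \<T>"
    and "acyclic (quiver q K L \<T>)"
  shows "morse_shellable (skeleton q K) (skeleton q L) \<and>
    (\<exists>N::nat. \<exists>S :: nat \<Rightarrow> 'a set.
       S 0 = {} \<and>
       (\<forall>j\<le>N. S j \<subseteq> relative_space K L) \<and>
       (\<forall>j\<le>N. closedin (top_of_set (relative_space (skeleton q K) (skeleton q L)))
                 (S j \<inter> relative_space (skeleton q K) (skeleton q L))) \<and>
       S N \<inter> relative_space (skeleton q K) (skeleton q L)
         = relative_space (skeleton q K) (skeleton q L) \<and>
       (\<forall>j\<in>{1..N}. S (j - 1) \<subseteq> S j \<and>
          (\<exists>T\<in>\<T>. tile_order_le T (q + 1) \<and> S j - S (j - 1) = T)))"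
proof
  let ?Q = "relative_space (skeleton q K) (skeleton q L)"
  note QS = relative_space_skeleton_subset[of q K L]
  have part: "\<Union>\<T> = relative_space K L" "disjoint \<T>"
    using assms(2) unfolding morse_tiling_def partition_on_def by auto
  have tile: "\<exists>\<sigma>\<in>K. \<exists>n k. morse_tile \<sigma> n k T" if "T \<in> \<T>" for T
    using assms(2) that unfolding morse_tiling_def by blast
  \<comment> \<open>With closures in place of underlying simplices, the quiver takes the form
    required by \<open>filtration_of_acyclic\<close>.\<close>
  have us: "underlying_simplex T = closure T" if "T \<in> \<T>" for T
    using tile[OF that] underlying_simplex_eq morse_tile_closure by metis
  have sub: "T \<subseteq> relative_space K L" if "T \<in> \<T>" for T
    using that part(1) by blast
  have vertex: "T \<in> quiver_vertices q \<T>" if "T \<in> \<T>" "x \<in> T" "x \<in> ?Q" for T x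
    using tile[OF that(1)] tile_order_le_of_meets_skeleton[OF assms(1) sub[OF that(1)] _ _ that(2,3)]
      that(1) unfolding quiver_vertices_def by blast
  have fin: "finite \<T>" using assms(2) by (rule finite_morse_tiling)

  \<comment> \<open>Filtration by the vertices of the quiver (second conjunct)\<close>
  let ?X = "quiver_vertices q \<T>"
  have X: "?X \<subseteq> \<T>" unfolding quiver_vertices_def by blast
  have "?Q \<subseteq> \<Union>?X"
    using vertex QS part(1) by blast
  moreover have "acyclic {(T, T'). T \<in> ?X \<and> T' \<in> ?X \<and> T \<noteq> T' \<and> closure T \<inter> T' \<inter> ?Q \<noteq> {}}"
    using assms(3) by (rule acyclic_subset) (use us X in \<open>auto simp: quiver_def\<close>)
  moreover have "disjoint ?X" using part(2) X by (rule pairwise_subset)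
  ultimately obtain N :: nat and S where S: "S 0 = {}" "S N = \<Union>?X"
    "\<forall>j\<le>N. S j \<subseteq> \<Union>?X \<and> closedin (top_of_set ?Q) (S j \<inter> ?Q)"
    "\<forall>j\<in>{1..N}. S (j - 1) \<subseteq> S j \<and> S j - S (j - 1) \<in> ?X"
    using filtration_of_acyclic[of ?X ?Q] finite_subset[OF X fin] by blast
  have "\<forall>j\<le>N. S j \<subseteq> relative_space K L" using S(3) X part(1) by blast
  moreover have "\<forall>j\<le>N. closedin (top_of_set ?Q) (S j \<inter> ?Q)" using S(3) by blast
  moreover have "S N \<inter> ?Q = ?Q" using S(2) \<open>?Q \<subseteq> \<Union>?X\<close> by blast
  moreover have "\<forall>j\<in>{1..N}. S (j - 1) \<subseteq> S j \<and>
      (\<exists>T\<in>\<T>. tile_order_le T (q + 1) \<and> S j - S (j - 1) = T)"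
    using S(4) unfolding quiver_vertices_def by blast
  ultimately show "\<exists>N::nat. \<exists>S :: nat \<Rightarrow> 'a set.
       S 0 = {} \<and> (\<forall>j\<le>N. S j \<subseteq> relative_space K L) \<and>
       (\<forall>j\<le>N. closedin (top_of_set ?Q) (S j \<inter> ?Q)) \<and> S N \<inter> ?Q = ?Q \<and>
       (\<forall>j\<in>{1..N}. S (j - 1) \<subseteq> S j \<and>
          (\<exists>T\<in>\<T>. tile_order_le T (q + 1) \<and> S j - S (j - 1) = T))"
    using S(1) by (intro exI[of _ N] exI[of _ S] conjI)

  \<comment> \<open>Tiling and shelling of the skeleton by pieces (first conjunct)\<close>
  have "\<forall>T\<in>\<T>. \<exists>P. \<exists>w :: 'a set \<Rightarrow> nat.
      finite P \<and> disjoint P \<and> {} \<notin> P \<and> \<Union>P = T \<inter> ?Q \<and>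
      (\<forall>p\<in>P. \<exists>\<tau>\<in>skeleton q K. \<exists>l. \<tau> \<subseteq> closure T \<and> morse_tile \<tau> (min (tile_dim T) q) l p) \<and>
      (\<forall>p\<in>P. \<forall>p'\<in>P. p \<noteq> p' \<and> closure p \<inter> p' \<noteq> {} \<longrightarrow> w p' < w p)"
  proof
    fix T assume T: "T \<in> \<T>"
    then obtain \<sigma> n k where \<sigma>: "\<sigma> \<in> K" "morse_tile \<sigma> n k T" using tile by blast
    show "\<exists>P. \<exists>w :: 'a set \<Rightarrow> nat.
        finite P \<and> disjoint P \<and> {} \<notin> P \<and> \<Union>P = T \<inter> ?Q \<and>
        (\<forall>p\<in>P. \<exists>\<tau>\<in>skeleton q K. \<exists>l. \<tau> \<subseteq> closure T \<and> morse_tile \<tau> (min (tile_dim T) q) l p) \<and>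
        (\<forall>p\<in>P. \<forall>p'\<in>P. p \<noteq> p' \<and> closure p \<inter> p' \<noteq> {} \<longrightarrow> w p' < w p)"
      using skeleton_of_tile[OF assms(1) sub[OF T] \<sigma>(2,1), of q]
      unfolding morse_tile_closure[OF \<sigma>(2)] tile_dim_eq[OF \<sigma>(2)] .
  qed
  \<comment> \<open>\<open>closure T\<close> and \<open>tile_dim T\<close> stand for the simplex and
    its dimension, so that \<open>P\<close> and \<open>w\<close> can be chosen as functions of the
    tile.\<close>
  then obtain P :: "'a set \<Rightarrow> 'a set set" and w :: "'a set \<Rightarrow> 'a set \<Rightarrow> nat" where Pw:
    "\<forall>T\<in>\<T>. finite (P T) \<and> disjoint (P T) \<and> {} \<notin> P T \<and> \<Union>(P T) = T \<inter> ?Q \<and>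
      (\<forall>p\<in>P T. \<exists>\<tau>\<in>skeleton q K. \<exists>l. \<tau> \<subseteq> closure T \<and> morse_tile \<tau> (min (tile_dim T) q) l p) \<and>
      (\<forall>p\<in>P T. \<forall>p'\<in>P T. p \<noteq> p' \<and> closure p \<inter> p' \<noteq> {} \<longrightarrow> w T p' < w T p)"
    by (simp only: bchoice_iff) (elim exE, rule that)
  have P_tile: "\<exists>\<tau>\<in>skeleton q K. \<exists>l. \<tau> \<subseteq> closure T \<and> morse_tile \<tau> (min (tile_dim T) q) l p"
    if "T \<in> \<T>" "p \<in> P T" for T p
    using Pw that by simp
  have P_Union: "\<Union>(P T) = T \<inter> ?Q" if "T \<in> \<T>" for T
    using Pw that by simp
  have P_sub: "p \<subseteq> T" "p \<subseteq> ?Q" if "T \<in> \<T>" "p \<in> P T" for T p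
    using Union_upper[OF that(2)] unfolding P_Union[OF that(1)] by auto
  have P_less: "w T p' < w T p"
    if "T \<in> \<T>" "p \<in> P T" "p' \<in> P T" "p \<noteq> p'" "closure p \<inter> p' \<noteq> {}" for T p p'
    using Pw that by simp
  have P_disjoint: "disjoint (P T)" "{} \<notin> P T" "finite (P T)" if "T \<in> \<T>" for T
    using Pw that by simp_all
  define \<P> where "\<P> = (\<Union>T\<in>\<T>. P T)"
  have \<P>_Union: "\<Union>\<P> = ?Q"
  proof -
    have "\<Union>\<P> = (\<Union>T\<in>\<T>. \<Union>(P T))" unfolding \<P>_def by blast
    also have "\<dots> = \<Union>\<T> \<inter> ?Q" using P_Union by simp
    finally show ?thesis using part(1) QS by (simp add: Int_absorb1)
  qed
  have parent: "T = T'" if "T \<in> \<T>" "T' \<in> \<T>" "p \<in> P T" "p' \<in> P T'" "p \<inter> p' \<noteq> {}" for T T' p p'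
  proof -
    have "T \<inter> T' \<noteq> {}" using P_sub(1)[OF that(1,3)] P_sub(1)[OF that(2,4)] that(5) by blast
    thus ?thesis using disjointD[OF part(2) that(1,2)] by blast
  qed
  have \<P>_disjoint: "disjoint \<P>"
  proof (rule disjointI)
    fix p p' assume p: "p \<in> \<P>" "p' \<in> \<P>" "p \<noteq> p'"
    then obtain T T' where T: "T \<in> \<T>" "T' \<in> \<T>" "p \<in> P T" "p' \<in> P T'" unfolding \<P>_def by blast
    show "p \<inter> p' = {}"
    proof (rule ccontr)
      assume ne: "p \<inter> p' \<noteq> {}"
      hence "T = T'" using parent T by blast
      thus False using disjointD[OF P_disjoint(1)[OF T(1)], of p p'] T ne p(3) by blast
    qed
  qed
  have \<P>_ne: "{} \<notin> \<P>" using P_disjoint(2) unfolding \<P>_def by blast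
  have tile_dim: "tile_dim p = min (tile_dim T) q" if "T \<in> \<T>" "p \<in> P T" for T p
    using P_tile[OF that] tile_dim_eq by blast
  \<comment> \<open>A piece of \<open>T\<close> has dimension \<open>min (tile_dim T) q\<close>. For
    \<open>j < q\<close> the union is therefore the trace of the corresponding closed union of
    tiles; for larger \<open>j\<close> it is empty.\<close>
  have dims: "closedin (top_of_set ?Q) (\<Union>{p \<in> \<P>. j < tile_dim p})" for j
  proof (cases "j < q")
    case True
    have "\<Union>{p \<in> \<P>. j < tile_dim p} = ?Q \<inter> \<Union>{T \<in> \<T>. j < tile_dim T}"
    proof (intro equalityI subsetI)
      fix x assume "x \<in> \<Union>{p \<in> \<P>. j < tile_dim p}"
      then obtain T p where T: "T \<in> \<T>" "p \<in> P T" "j < tile_dim p" "x \<in> p"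
        unfolding \<P>_def by blast
      have "x \<in> T \<inter> ?Q" using P_sub[OF T(1,2)] T(4) by blast
      moreover have "j < tile_dim T" using tile_dim T by simp
      ultimately show "x \<in> ?Q \<inter> \<Union>{T \<in> \<T>. j < tile_dim T}" using T(1) by blast
    next
      fix x assume "x \<in> ?Q \<inter> \<Union>{T \<in> \<T>. j < tile_dim T}"
      then obtain T where T: "T \<in> \<T>" "j < tile_dim T" "x \<in> T \<inter> ?Q" by blast
      then obtain p where p: "p \<in> P T" "x \<in> p" unfolding P_Union[OF T(1), symmetric] by blast
      hence "j < tile_dim p" using tile_dim T True by simp
      thus "x \<in> \<Union>{p \<in> \<P>. j < tile_dim p}" using p T(1) unfolding \<P>_def by blast
    qed
    moreover have "closedin (top_of_set (relative_space K L)) (\<Union>{T \<in> \<T>. j < tile_dim T})"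
      using assms(2) unfolding morse_tiling_def by simp
    then obtain C where C: "closed C" "\<Union>{T \<in> \<T>. j < tile_dim T} = relative_space K L \<inter> C"
      unfolding closedin_closed by blast
    moreover have "?Q \<inter> (relative_space K L \<inter> C) = ?Q \<inter> C" using QS by blast
    ultimately show ?thesis using closedin_closed_Int[OF C(1), of ?Q] by simp
  next
    case False
    hence "\<not> j < tile_dim p" if "p \<in> \<P>" for p
      using that tile_dim unfolding \<P>_def by auto
    hence "{p \<in> \<P>. j < tile_dim p} = {}" by blast
    thus ?thesis by (simp only: Union_empty closedin_empty)
  qed
  have tiling: "morse_tiling (skeleton q K) (skeleton q L) \<P>"
  proof -
    have "\<forall>p\<in>\<P>. \<exists>\<tau>\<in>skeleton q K. \<exists>n l. morse_tile \<tau> n l p"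
      using P_tile unfolding \<P>_def by blast
    thus ?thesis
      using relative_simplicial_complex_skeleton[OF assms(1)] \<P>_Union \<P>_disjoint \<P>_ne dims
      unfolding morse_tiling_def partition_on_def by simp
  qed
  define E where "E = {(p, p'). p \<in> \<P> \<and> p' \<in> \<P> \<and> p \<noteq> p' \<and> closure p \<inter> p' \<inter> ?Q \<noteq> {}}"
  have "\<forall>p\<in>\<P>. \<exists>T\<in>\<T>. p \<in> P T" unfolding \<P>_def by blast
  then obtain \<pi> where \<pi>: "\<And>p. p \<in> \<P> \<Longrightarrow> \<pi> p \<in> \<T>" "\<And>p. p \<in> \<P> \<Longrightarrow> p \<in> P (\<pi> p)"
    by metis
  have arrow: "\<pi> p = \<pi> p' \<and> w (\<pi> p) p' < w (\<pi> p) p \<or> (\<pi> p, \<pi> p') \<in> quiver q K L \<T>"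
    if "(p, p') \<in> E" for p p'
  proof -
    from that obtain x where p: "p \<in> \<P>" "p' \<in> \<P>" "p \<noteq> p'" and x: "x \<in> closure p" "x \<in> p'" "x \<in> ?Q"
      unfolding E_def by blast
    show ?thesis
    proof (cases "\<pi> p = \<pi> p'")
      case True
      have "closure p \<inter> p' \<noteq> {}" using x by blast
      thus ?thesis using P_less[OF \<pi>(1,2)[OF p(1)] _ p(3)] \<pi>(2)[OF p(2)] True by simp
    next
      case False
      \<comment> \<open>For \<open>\<pi> p\<close> to be a vertex of the quiver, the tile itself
        must meet the skeleton. The point \<open>x\<close> is only known to lie in its closure, so a
        point of \<open>p\<close> is used.\<close>
      obtain y where y: "y \<in> p" using \<P>_ne p(1) by (metis ex_in_conv)
      have "p \<subseteq> \<pi> p" "p \<subseteq> ?Q" "p' \<subseteq> \<pi> p'"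
        using P_sub[OF \<pi>(1,2)[OF p(1)]] P_sub(1)[OF \<pi>(1,2)[OF p(2)]] by auto
      hence "x \<in> closure (\<pi> p)" "x \<in> \<pi> p'" "y \<in> \<pi> p" "y \<in> ?Q"
        using x y closure_mono[of p "\<pi> p"] by blast+
      hence "\<pi> p \<in> ?X" "\<pi> p' \<in> ?X" "underlying_simplex (\<pi> p) \<inter> \<pi> p' \<inter> ?Q \<noteq> {}"
        using vertex \<pi>(1) p(1,2) x(3) us by auto
      thus ?thesis using False unfolding quiver_def by simp
    qed
  qed
  have "wf ((quiver q K L \<T>)\<inverse>)"
  proof (rule finite_acyclic_wf_converse[OF _ assms(3)])
    have "quiver q K L \<T> \<subseteq> \<T> \<times> \<T>" using X unfolding quiver_def by blast
    thus "finite (quiver q K L \<T>)" using fin finite_subset by blast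
  qed
  \<comment> \<open>An arrow of \<open>E\<close> either follows an arrow of the quiver or stays in
    one tile and lowers the weight, hence the lexicographic order. The converse appears because
    descent goes along the arrows.\<close>
  hence "wf (inv_image ((quiver q K L \<T>)\<inverse> <*lex*> less_than) (\<lambda>p. (\<pi> p, w (\<pi> p) p)))"
    by (intro wf_inv_image wf_lex_prod) auto
  moreover have "E\<inverse> \<subseteq> inv_image ((quiver q K L \<T>)\<inverse> <*lex*> less_than) (\<lambda>p. (\<pi> p, w (\<pi> p) p))"
  proof (rule subrelI)
    fix p' p assume "(p', p) \<in> E\<inverse>"
    hence "\<pi> p = \<pi> p' \<and> w (\<pi> p) p' < w (\<pi> p) p \<or> (\<pi> p, \<pi> p') \<in> quiver q K L \<T>"
      using arrow by simp
    thus "(p', p) \<in> inv_image ((quiver q K L \<T>)\<inverse> <*lex*> less_than) (\<lambda>p. (\<pi> p, w (\<pi> p) p))"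
      by auto
  qed
  ultimately have "acyclic E"
    by (metis wf_subset wf_acyclic acyclic_converse)
  moreover have "finite \<P>" using fin P_disjoint(3) unfolding \<P>_def by blast
  ultimately obtain N :: nat and S where S: "S 0 = {}" "S N = \<Union>\<P>"
    "\<forall>j\<le>N. S j \<subseteq> \<Union>\<P> \<and> closedin (top_of_set ?Q) (S j \<inter> ?Q)"
    "\<forall>j\<in>{1..N}. S (j - 1) \<subseteq> S j \<and> S j - S (j - 1) \<in> \<P>"
    using filtration_of_acyclic[of \<P> ?Q] \<P>_disjoint \<P>_Union unfolding E_def by blast
  \<comment> \<open>The pieces fill exactly the skeleton, so the closed traces are the sets
    \<open>S j\<close> themselves.\<close>
  have "S j \<inter> ?Q = S j" if "j \<le> N" for j using S(3) that \<P>_Union by blast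
  hence "\<forall>j\<le>N. closedin (top_of_set ?Q) (S j)" using S(3) by metis
  hence "shellable_tiling (skeleton q K) (skeleton q L) \<P>"
    unfolding shellable_tiling_def
    using tiling S(1,4) S(2)[unfolded \<P>_Union]
    by (intro conjI exI[of _ N] exI[of _ S])
  thus "morse_shellable (skeleton q K) (skeleton q L)"
    unfolding morse_shellable_def by blast
qed

end
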